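(* Let $H$ be a graph that has a severed pair. Then the line graph of $H$ is deletion-normal.
   Context: All graphs are finite, without loops or parallel edges. A leaf is a vertex of degree one. A claw component of $H$ is a component of $H$ isomorphic to $K_{1,3}$. A pair $(x_1,x_2)$ of vertices of $H$ is severed if: (i) $x_1,x_2$ are leaves of $H$ at distance at least three from each other (that is, $x_1,x_2$ are non-adjacent and their unique neighbors in $H$ are distinct; they may lie in different components); and (ii) neither $x_1$ nor $x_2$ belongs to a claw component of $H$. The line graph of $H$ has vertex set $E(H)$, with two distinct edges of $H$ adjacent if and only if they share an end. A graph $G$ is $F$-free if it has no induced subgraph isomorphic to $F$. A graph $G$ is $F$-deletion-saturated if $G$ is $F$-free, $E(G)\neq\varnothing$, and for every edge $e\in E(G)$ the graph $G-e$ is not $F$-free. A graph $F$ is deletion-normal if there exists a (finite) $F$-deletion-saturated graph. *)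

theory Defs
  imports Main "HOL-Library.Extended_Nat"
begin

record 'a ugraph =
  verts :: "'a set"
  edges :: "'a set set"

text \<open>Edges are two-element sets of vertices, so loops and parallel edges are excluded.\<close>

definition finite_graph :: "'a ugraph \<Rightarrow> bool" where
  "finite_graph G \<longleftrightarrow> finite (verts G) \<and> (\<forall>e\<in>edges G. e \<subseteq> verts G \<and> card e = 2)"

definition adj_rel :: "'a ugraph \<Rightarrow> ('a \<times> 'a) set" where
  "adj_rel G = {(u, v). {u, v} \<in> edges G}"

definition degree :: "'a ugraph \<Rightarrow> 'a \<Rightarrow> nat" where
  "degree G v = card {e \<in> edges G. v \<in> e}"

definition leaf :: "'a ugraph \<Rightarrow> 'a \<Rightarrow> bool" where
  "leaf G v \<longleftrightarrow> v \<in> verts G \<and> degree G v = 1"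

text \<open>The least length of a walk from \<open>u\<close> to \<open>v\<close>; it is \<open>\<infinity>\<close> if there is none, since
  the infimum of the empty set is the top element.\<close>

definition distance :: "'a ugraph \<Rightarrow> 'a \<Rightarrow> 'a \<Rightarrow> enat" where
  "distance G u v = (INF n \<in> {n. (u, v) \<in> adj_rel G ^^ n}. enat n)"

definition induced :: "'a ugraph \<Rightarrow> 'a set \<Rightarrow> 'a ugraph" where
  "induced G S = \<lparr>verts = S, edges = {e \<in> edges G. e \<subseteq> S}\<rparr>"

definition isomorphic :: "'a ugraph \<Rightarrow> 'b ugraph \<Rightarrow> bool" (infix \<open>\<cong>\<^sub>g\<close> 50) where
  "G \<cong>\<^sub>g H \<longleftrightarrow> (\<exists>f. bij_betw f (verts G) (verts H) \<and>
     (\<forall>u\<in>verts G. \<forall>v\<in>verts G. {u, v} \<in> edges G \<longleftrightarrow> {f u, f v} \<in> edges H))"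

definition components :: "'a ugraph \<Rightarrow> 'a ugraph set" where
  "components G = {induced G {u \<in> verts G. (v, u) \<in> (adj_rel G)\<^sup>*} | v. v \<in> verts G}"

definition claw :: "nat ugraph" where
  "claw = \<lparr>verts = {0, 1, 2, 3}, edges = {{0, 1}, {0, 2}, {0, 3}}\<rparr>"

definition severed :: "'a ugraph \<Rightarrow> 'a \<Rightarrow> 'a \<Rightarrow> bool" where
  "severed H x y \<longleftrightarrow> leaf H x \<and> leaf H y \<and> distance H x y \<ge> 3 \<and>
     (\<forall>C\<in>components H. C \<cong>\<^sub>g claw \<longrightarrow> x \<notin> verts C \<and> y \<notin> verts C)"

definition line_graph :: "'a ugraph \<Rightarrow> 'a set ugraph" where
  "line_graph H = \<lparr>verts = edges H,
     edges = {{e, f} | e f. e \<in> edges H \<and> f \<in> edges H \<and> e \<noteq> f \<and> e \<inter> f \<noteq> {}}\<rparr>"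

definition graph_free :: "'b ugraph \<Rightarrow> 'a ugraph \<Rightarrow> bool" where
  "graph_free F G \<longleftrightarrow> \<not> (\<exists>S\<subseteq>verts G. induced G S \<cong>\<^sub>g F)"

definition delete_edge :: "'a ugraph \<Rightarrow> 'a set \<Rightarrow> 'a ugraph" where
  "delete_edge G e = \<lparr>verts = verts G, edges = edges G - {e}\<rparr>"

definition deletion_saturated :: "'b ugraph \<Rightarrow> 'a ugraph \<Rightarrow> bool" where
  "deletion_saturated F G \<longleftrightarrow> finite_graph G \<and> graph_free F G \<and> edges G \<noteq> {} \<and>
     (\<forall>e\<in>edges G. \<not> graph_free F (delete_edge G e))"

text \<open>HOL has no quantification over types inside a formula; since every finite graph is
  isomorphic to one on natural numbers, restricting the witness to \<open>nat\<close> loses nothing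
  (lemma \<open>deletion_normalI\<close> below).\<close>

definition deletion_normal :: "'b ugraph \<Rightarrow> bool" where
  "deletion_normal F \<longleftrightarrow> (\<exists>G :: nat ugraph. deletion_saturated F G)"

lemma finite_graph_line_graph:
  assumes "finite_graph H" shows "finite_graph (line_graph H)"
proof -
  have "edges H \<subseteq> Pow (verts H)" "finite (verts H)"
    using assms by (auto simp: finite_graph_def)
  then have "finite (edges H)" by (meson finite_Pow_iff finite_subset)
  moreover have "d \<subseteq> edges H \<and> card d = 2" if "d \<in> edges (line_graph H)" for d
  proof -
    from that obtain e f where "d = {e, f}" "e \<in> edges H" "f \<in> edges H" "e \<noteq> f"
      unfolding line_graph_def by auto
    then show ?thesis by simp
  qed
  moreover have "verts (line_graph H) = edges H" by (simp add: line_graph_def)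
  ultimately show ?thesis unfolding finite_graph_def by simp
qed

lemma isomorphic_trans:
  assumes "G \<cong>\<^sub>g H" "H \<cong>\<^sub>g K" shows "G \<cong>\<^sub>g K"
proof -
  from assms obtain f g where f: "bij_betw f (verts G) (verts H)"
      "\<forall>u\<in>verts G. \<forall>v\<in>verts G. {u, v} \<in> edges G \<longleftrightarrow> {f u, f v} \<in> edges H"
    and g: "bij_betw g (verts H) (verts K)"
      "\<forall>u\<in>verts H. \<forall>v\<in>verts H. {u, v} \<in> edges H \<longleftrightarrow> {g u, g v} \<in> edges K"
    unfolding isomorphic_def by blast
  have "bij_betw (g \<circ> f) (verts G) (verts K)" using f g bij_betw_trans by blast
  moreover have "\<forall>u\<in>verts G. f u \<in> verts H" using f(1) bij_betwE by blast
  ultimately show ?thesis using f(2) g(2) unfolding isomorphic_def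
    by (intro exI[of _ "g \<circ> f"]) auto
qed

lemma isomorphic_sym:
  assumes "G \<cong>\<^sub>g H" shows "H \<cong>\<^sub>g G"
proof -
  from assms obtain f where f: "bij_betw f (verts G) (verts H)"
      "\<forall>u\<in>verts G. \<forall>v\<in>verts G. {u, v} \<in> edges G \<longleftrightarrow> {f u, f v} \<in> edges H"
    unfolding isomorphic_def by blast
  let ?g = "inv_into (verts G) f"
  have "bij_betw ?g (verts H) (verts G)" using f(1) bij_betw_inv_into by blast
  moreover have "\<forall>u\<in>verts H. ?g u \<in> verts G \<and> f (?g u) = u"
    using f(1) by (metis bij_betw_def f_inv_into_f inv_into_into)
  ultimately show ?thesis using f(2) unfolding isomorphic_def
    by (intro exI[of _ ?g]) auto
qed

lemma graph_free_isomorphic: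
  assumes "G \<cong>\<^sub>g G'" "graph_free F G" shows "graph_free F G'"
  unfolding graph_free_def
proof
  assume "\<exists>S\<subseteq>verts G'. induced G' S \<cong>\<^sub>g F"
  then obtain S where S: "S \<subseteq> verts G'" "induced G' S \<cong>\<^sub>g F" by blast
  obtain f where f: "bij_betw f (verts G') (verts G)"
      "\<forall>u\<in>verts G'. \<forall>v\<in>verts G'. {u, v} \<in> edges G' \<longleftrightarrow> {f u, f v} \<in> edges G"
    using isomorphic_sym[OF assms(1)] unfolding isomorphic_def by blast
  have "bij_betw f S (f ` S)"
    using f(1) S(1) by (meson bij_betw_subset order_refl)
  then have "induced G' S \<cong>\<^sub>g induced G (f ` S)"
    using f(2) S(1) unfolding isomorphic_def induced_def by (intro exI[of _ f]) auto
  then have "induced G (f ` S) \<cong>\<^sub>g F"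
    using S(2) isomorphic_trans isomorphic_sym by blast
  moreover have "f ` S \<subseteq> verts G" using f(1) S(1) by (auto simp: bij_betw_def)
  ultimately show False using assms(2) unfolding graph_free_def by blast
qed

lemma deletion_normalI:
  fixes G :: "'a ugraph"
  assumes "deletion_saturated F G" shows "deletion_normal F"
proof -
  have fin: "finite (verts G)" and ed: "\<And>e. e \<in> edges G \<Longrightarrow> e \<subseteq> verts G \<and> card e = 2"
    using assms by (auto simp: deletion_saturated_def finite_graph_def)
  obtain h :: "'a \<Rightarrow> nat" where h: "inj_on h (verts G)"
    using finite_imp_inj_to_nat_seg[OF fin] by auto
  define G' where "G' = \<lparr>verts = h ` verts G, edges = (`) h ` edges G\<rparr>"
  have img: "h ` e = h ` e' \<longleftrightarrow> e = e'" if "e \<subseteq> verts G" "e' \<subseteq> verts G" for e e'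
    using inj_on_image_eq_iff[OF h that] .
  have mem: "h ` e \<in> edges G' \<longleftrightarrow> e \<in> edges G" if "e \<subseteq> verts G" for e
  proof
    assume "h ` e \<in> edges G'"
    then obtain d where "d \<in> edges G" "h ` e = h ` d" by (auto simp: G'_def)
    then show "e \<in> edges G" using img[OF that, of d] ed[of d] by simp
  qed (simp add: G'_def)
  have mem2: "{h u, h v} \<in> edges G' \<longleftrightarrow> {u, v} \<in> edges G"
    if "u \<in> verts G" "v \<in> verts G" for u v
    using mem[of "{u, v}"] that by simp
  have bij: "bij_betw h (verts G) (verts G')" using h by (simp add: G'_def bij_betw_def)
  have iso: "G \<cong>\<^sub>g G'" unfolding isomorphic_def using bij mem2 by blast
  have isod: "delete_edge G e \<cong>\<^sub>g delete_edge G' (h ` e)" if e: "e \<in> edges G" for e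
  proof -
    have "{h u, h v} = h ` e \<longleftrightarrow> {u, v} = e" if "u \<in> verts G" "v \<in> verts G" for u v
      using img[of "{u, v}" e] that ed[OF e] by simp
    then show ?thesis unfolding isomorphic_def delete_edge_def
      using bij mem2 by (intro exI[of _ h]) simp
  qed
  have "finite_graph G'"
    unfolding finite_graph_def
  proof (intro conjI ballI)
    show "finite (verts G')" using fin by (simp add: G'_def)
  next
    fix e assume "e \<in> edges G'"
    then obtain d where d: "d \<in> edges G" "e = h ` d" by (auto simp: G'_def)
    show "e \<subseteq> verts G'" using ed[OF d(1)] d(2) by (auto simp: G'_def)
    show "card e = 2" using ed[OF d(1)] d(2) card_image inj_on_subset[OF h] by metis
  qed
  moreover have "graph_free F G'"
    using iso assms graph_free_isomorphic unfolding deletion_saturated_def by blast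
  moreover have "edges G' \<noteq> {}" using assms by (simp add: deletion_saturated_def G'_def)
  moreover have "\<not> graph_free F (delete_edge G' e)" if "e \<in> edges G'" for e
  proof -
    from that obtain d where "d \<in> edges G" "e = h ` d" by (auto simp: G'_def)
    then show ?thesis
      using isod isomorphic_sym graph_free_isomorphic assms unfolding deletion_saturated_def by blast
  qed
  ultimately show ?thesis unfolding deletion_normal_def deletion_saturated_def by blast
qed

lemma distance_ge_3_iff:
  "distance G x y \<ge> 3 \<longleftrightarrow> x \<noteq> y \<and> {x, y} \<notin> edges G \<and>
     \<not> (\<exists>z. {x, z} \<in> edges G \<and> {y, z} \<in> edges G)"
proof -
  have "distance G x y \<ge> 3 \<longleftrightarrow> (\<forall>n<3. (x, y) \<notin> adj_rel G ^^ n)"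
    unfolding distance_def le_INF_iff by (auto simp: numeral_eq_enat not_less[symmetric])
  also have "\<dots> \<longleftrightarrow> (x, y) \<notin> adj_rel G ^^ 0 \<and> (x, y) \<notin> adj_rel G ^^ 1 \<and> (x, y) \<notin> adj_rel G ^^ 2"
    by (auto simp: less_Suc_eq numeral_eq_Suc)
  also have "\<dots> \<longleftrightarrow> x \<noteq> y \<and> {x, y} \<notin> edges G \<and>
     \<not> (\<exists>z. {x, z} \<in> edges G \<and> {y, z} \<in> edges G)"
    by (auto simp: numeral_eq_Suc adj_rel_def relcomp_unfold insert_commute)
  finally show ?thesis .
qed

end

theory Submission
  imports Defs
begin

text \<open>
  Let \<open>F\<close> be the line graph of \<open>H\<close>, and let \<open>a\<close>, \<open>b\<close> be the edges of \<open>H\<close> at the two leaves of a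
  severed pair. Identifying the two leaves makes \<open>a\<close> and \<open>b\<close> meet in a vertex of degree two; it
  creates no loop or parallel edge because the leaves are at distance at least three. The resulting
  graph has one vertex less than \<open>H\<close>, and its line graph is \<open>F\<close> with the edge \<open>{a, b}\<close> added.

  This suggests taking the line graph of a complete graph as the saturated graph. Let \<open>V\<close> be a
  smallest set such that \<open>F\<close> is an induced subgraph of the line graph \<open>L(K\<^sub>V)\<close>; in other words, \<open>V\<close>
  is the vertex set of a smallest graph \<open>J\<close> with \<open>L(J) \<cong> F\<close>. If \<open>W\<close> has one element less,
  then \<open>L(K\<^sub>W)\<close> is \<open>F\<close>-free by minimality. If moreover \<open>F\<close> with the edge \<open>{a, b}\<close> added is induced
  in \<open>L(K\<^sub>W)\<close>, then \<open>F\<close> is induced in \<open>L(K\<^sub>W)\<close> minus one edge, and hence in \<open>L(K\<^sub>W)\<close>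
  minus any edge, because the permutations of \<open>W\<close> act transitively on the edges of \<open>L(K\<^sub>W)\<close>
  (lemma \<open>saturated_line_graph_of_complete\<close>).

  It remains to identify two leaves in \<open>J\<close> rather than in \<open>H\<close>
  (lemma \<open>glue_private_ends\<close>), for which the edges of \<open>J\<close> that correspond to \<open>a\<close> and \<open>b\<close> must be
  pendant as well. Suppose that the one for \<open>a\<close> is not. The neighbours of \<open>a\<close> in \<open>F\<close> form a clique,
  so this edge lies in a triangle of \<open>J\<close>, and it turns out that either the component of \<open>a\<close> in \<open>H\<close> is
  a claw, which is excluded, or it is a triangle with a pendant edge. In the latter case the line
  graph of the component is \<open>K\<^sub>4\<close> minus an edge, with an automorphism that exchanges \<open>a\<close> with the
  opposite edge of the triangle, and applying it makes \<open>a\<close> pendant in \<open>J\<close>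
  (lemma \<open>leaf_edge_gets_private_end\<close>). This argument replaces Whitney's theorem on graphs with
  isomorphic line graphs.
\<close>

section \<open>Induced subgraphs of line graphs of complete graphs\<close>

definition complete_graph :: "'a set \<Rightarrow> 'a ugraph" where
  "complete_graph V = \<lparr>verts = V, edges = {e. e \<subseteq> V \<and> card e = 2}\<rparr>"

definition add_edge :: "'a ugraph \<Rightarrow> 'a set \<Rightarrow> 'a ugraph" where
  "add_edge F e = \<lparr>verts = verts F, edges = insert e (edges F)\<rparr>"

text \<open>An isomorphism from \<open>F\<close> onto an induced subgraph of the line graph of the complete graph on
  \<open>V\<close>. Its range is the edge set of a graph on \<open>V\<close> whose line graph is \<open>F\<close>; below this graph
  is called \<open>J\<close>.\<close>

definition line_model :: "'b ugraph \<Rightarrow> 'a set \<Rightarrow> ('b \<Rightarrow> 'a set) \<Rightarrow> bool" where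
  "line_model F V \<phi> \<longleftrightarrow> inj_on \<phi> (verts F) \<and> (\<forall>u\<in>verts F. \<phi> u \<subseteq> V \<and> card (\<phi> u) = 2) \<and>
     (\<forall>u\<in>verts F. \<forall>v\<in>verts F. u \<noteq> v \<longrightarrow> ({u, v} \<in> edges F \<longleftrightarrow> \<phi> u \<inter> \<phi> v \<noteq> {}))"

text \<open>The edge of \<open>J\<close> that represents \<open>u\<close> is pendant, and \<open>z\<close> is its leaf. (If both of its ends
  have degree one, then each of them is such a \<open>z\<close>.)\<close>

definition private_end :: "'b ugraph \<Rightarrow> ('b \<Rightarrow> 'a set) \<Rightarrow> 'b \<Rightarrow> 'a \<Rightarrow> bool" where
  "private_end F \<phi> u z \<longleftrightarrow> z \<in> \<phi> u \<and> (\<forall>v\<in>verts F. v \<noteq> u \<longrightarrow> z \<notin> \<phi> v)"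

lemma line_graph_edge_iff:
  "{e, f} \<in> edges (line_graph H) \<longleftrightarrow> e \<in> edges H \<and> f \<in> edges H \<and> e \<noteq> f \<and> e \<inter> f \<noteq> {}"
  unfolding line_graph_def by (auto simp: doubleton_eq_iff)

lemma finite_graph_complete_graph: "finite V \<Longrightarrow> finite_graph (complete_graph V)"
  unfolding finite_graph_def complete_graph_def by simp

lemma line_model_of_induced:
  assumes "\<not> graph_free F (line_graph (complete_graph V))"
  shows "\<exists>\<phi>. line_model F V \<phi>"
proof -
  obtain S where S: "S \<subseteq> verts (line_graph (complete_graph V))"
      and "induced (line_graph (complete_graph V)) S \<cong>\<^sub>g F"
    using assms unfolding graph_free_def by blast
  then have "F \<cong>\<^sub>g induced (line_graph (complete_graph V)) S" using isomorphic_sym by blast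
  then obtain \<phi> where bij: "bij_betw \<phi> (verts F) S"
    and \<phi>: "\<forall>u\<in>verts F. \<forall>v\<in>verts F. {u, v} \<in> edges F
      \<longleftrightarrow> {\<phi> u, \<phi> v} \<in> edges (induced (line_graph (complete_graph V)) S)"
    unfolding isomorphic_def by (auto simp: induced_def)
  have S': "\<forall>d\<in>S. d \<in> edges (complete_graph V)" using S by (auto simp: line_graph_def)
  have im: "\<forall>u\<in>verts F. \<phi> u \<in> S" using bij bij_betwE by blast
  have inj: "inj_on \<phi> (verts F)" using bij by (simp add: bij_betw_def)
  have "{u, v} \<in> edges F \<longleftrightarrow> \<phi> u \<inter> \<phi> v \<noteq> {}" if "u \<in> verts F" "v \<in> verts F" "u \<noteq> v" for u v
  proof -
    have "{u, v} \<in> edges F \<longleftrightarrow> {\<phi> u, \<phi> v} \<in> edges (line_graph (complete_graph V))"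
      using \<phi> im that by (simp add: induced_def)
    moreover have "\<phi> u \<noteq> \<phi> v" using inj that by (auto dest: inj_onD)
    ultimately show ?thesis using im S' that by (simp add: line_graph_edge_iff)
  qed
  moreover have "\<phi> u \<subseteq> V \<and> card (\<phi> u) = 2" if "u \<in> verts F" for u
    using im S' that by (simp add: complete_graph_def)
  ultimately have "line_model F V \<phi>" using inj by (simp add: line_model_def)
  then show ?thesis by blast
qed

section \<open>Saturation of line graphs of complete graphs\<close>

text \<open>The edges of the line graph of a complete graph are the pairs of edges \<open>{v, s}\<close>, \<open>{v, t}\<close>, so
  extending maps between triples to permutations is what makes its automorphism group transitive
  on edges.\<close>

lemma bij_extending_triple:
  assumes "finite W" "{v, s, t} \<subseteq> W" "{v', s', t'} \<subseteq> W"
    and "distinct [v, s, t]" "distinct [v', s', t']"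
  shows "\<exists>\<pi>. bij_betw \<pi> W W \<and> \<pi> v = v' \<and> \<pi> s = s' \<and> \<pi> t = t'"
proof -
  let ?A = "{v, s, t}" and ?B = "{v', s', t'}"
  have "card (W - ?A) = card (W - ?B)"
    using assms by (simp add: card_Diff_subset)
  then obtain g where g: "bij_betw g (W - ?A) (W - ?B)"
    using assms(1) finite_same_card_bij by (metis finite_Diff)
  define \<pi> where "\<pi> = (\<lambda>x. if x = v then v' else if x = s then s' else if x = t then t' else g x)"
  have "bij_betw \<pi> ?A ?B"
    using assms(4,5) by (auto simp: \<pi>_def bij_betw_def inj_on_def)
  moreover have "bij_betw \<pi> (W - ?A) (W - ?B)"
    using g by (rule bij_betw_cong[THEN iffD1, rotated]) (auto simp: \<pi>_def)
  ultimately have "bij_betw \<pi> (?A \<union> (W - ?A)) (?B \<union> (W - ?B))"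
    by (rule bij_betw_combine) blast
  moreover have "?A \<union> (W - ?A) = W" "?B \<union> (W - ?B) = W" using assms(2,3) by auto
  ultimately have "bij_betw \<pi> W W" by simp
  moreover have "\<pi> v = v'" "\<pi> s = s'" "\<pi> t = t'" using assms(4) by (auto simp: \<pi>_def)
  ultimately show ?thesis by blast
qed

lemma card_2_mem_obtain:
  assumes "card p = 2" "v \<in> p"
  obtains s where "p = {v, s}" "v \<noteq> s"
proof -
  obtain c d where "p = {c, d}" "c \<noteq> d" using assms(1) by (auto simp: card_2_iff)
  then show thesis using that[of c] that[of d] assms(2) by auto
qed

lemma card_2_eqI:
  assumes "card p = 2" "c \<in> p" "d \<in> p" "c \<noteq> d"
  shows "p = {c, d}"
  using card_2_mem_obtain[OF assms(1,2)] assms(3,4) by blast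

lemma crossing_pairs:
  assumes "card p = 2" "card q = 2" "p \<noteq> q" "p \<inter> q \<noteq> {}"
  obtains v s t where "p = {v, s}" "q = {v, t}" "distinct [v, s, t]"
proof -
  obtain v where v: "v \<in> p" "v \<in> q" using assms(4) by blast
  obtain s where s: "p = {v, s}" "v \<noteq> s" using card_2_mem_obtain[OF assms(1) v(1)] .
  obtain t where t: "q = {v, t}" "v \<noteq> t" using card_2_mem_obtain[OF assms(2) v(2)] .
  show thesis using that s t assms(3) by auto
qed

lemma line_model_image:
  assumes "line_model F V \<phi>" "inj_on \<pi> V" "\<pi> ` V \<subseteq> W"
  shows "line_model F W (\<lambda>u. \<pi> ` \<phi> u)"
proof -
  have sub: "\<phi> u \<subseteq> V" "card (\<phi> u) = 2" if "u \<in> verts F" for u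
    using assms(1) that by (auto simp: line_model_def)
  have "inj_on (\<lambda>u. \<pi> ` \<phi> u) (verts F)"
    using assms(1) sub inj_on_image_eq_iff[OF assms(2)] by (auto simp: line_model_def inj_on_def)
  moreover have "card (\<pi> ` \<phi> u) = 2" if "u \<in> verts F" for u
    using sub[OF that] card_image inj_on_subset[OF assms(2)] by metis
  moreover have "\<pi> ` \<phi> u \<subseteq> W" if "u \<in> verts F" for u
    using sub(1)[OF that] assms(3) by blast
  moreover have "\<pi> ` \<phi> u \<inter> \<pi> ` \<phi> v = \<pi> ` (\<phi> u \<inter> \<phi> v)"
    if "u \<in> verts F" "v \<in> verts F" for u v
    using inj_on_image_Int[OF assms(2) sub(1)[OF that(1)] sub(1)[OF that(2)]] by simp
  ultimately show ?thesis using assms(1) unfolding line_model_def by simp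
qed

text \<open>A copy of \<open>F\<close> plus the edge \<open>{a, b}\<close> turns into a copy of \<open>F\<close> once the edge \<open>d\<close> that represents
  \<open>{a, b}\<close> is deleted. By symmetry the copy can be moved so that \<open>d\<close> is any prescribed edge.\<close>

lemma saturated_line_graph_of_complete:
  assumes F: "finite_graph F" and ab: "a \<in> verts F" "b \<in> verts F" "a \<noteq> b" "{a, b} \<notin> edges F"
    and W: "finite W" and none: "\<nexists>\<phi>. line_model F W \<phi>"
    and \<psi>: "line_model (add_edge F {a, b}) W \<psi>"
  shows "deletion_saturated F (line_graph (complete_graph W))" (is "deletion_saturated F ?G")
proof -
  have inj: "inj_on \<psi> (verts F)" and wf: "\<And>u. u \<in> verts F \<Longrightarrow> \<psi> u \<subseteq> W \<and> card (\<psi> u) = 2"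
    using \<psi> by (auto simp: line_model_def add_edge_def)
  have \<psi>ab: "\<psi> a \<inter> \<psi> b \<noteq> {}" using \<psi> ab by (auto simp: line_model_def add_edge_def)
  have \<psi>ne: "\<psi> a \<noteq> \<psi> b" using inj ab by (auto dest: inj_onD)
  obtain v s t where vst: "\<psi> a = {v, s}" "\<psi> b = {v, t}" "distinct [v, s, t]"
    using crossing_pairs[of "\<psi> a" "\<psi> b"] wf ab \<psi>ab \<psi>ne by metis
  have "\<not> graph_free F (delete_edge ?G d)" if d: "d \<in> edges ?G" for d
  proof -
    obtain p q where pq: "d = {p, q}" "p \<in> edges (complete_graph W)" "q \<in> edges (complete_graph W)"
        "p \<noteq> q" "p \<inter> q \<noteq> {}"
      using d by (auto simp: line_graph_def)
    then obtain v' s' t' where vst': "p = {v', s'}" "q = {v', t'}" "distinct [v', s', t']"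
      using crossing_pairs[of p q] by (auto simp: complete_graph_def)
    have "{v, s, t} \<subseteq> W" using wf[OF ab(1)] wf[OF ab(2)] vst by auto
    moreover have "{v', s', t'} \<subseteq> W" using pq(2,3) vst' by (auto simp: complete_graph_def)
    ultimately obtain \<pi> where \<pi>: "bij_betw \<pi> W W" "\<pi> v = v'" "\<pi> s = s'" "\<pi> t = t'"
      using bij_extending_triple[OF W _ _ vst(3) vst'(3)] by blast
    define \<chi> where "\<chi> = (\<lambda>u. \<pi> ` \<psi> u)"
    have \<chi>: "line_model (add_edge F {a, b}) W \<chi>"
      using line_model_image[OF \<psi>, of \<pi> W] \<pi>(1) unfolding \<chi>_def bij_betw_def by simp
    have d_eq: "d = {\<chi> a, \<chi> b}" using pq(1) vst vst' \<pi> by (simp add: \<chi>_def)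
    have inj\<chi>: "inj_on \<chi> (verts F)" and wf\<chi>: "\<And>u. u \<in> verts F \<Longrightarrow> \<chi> u \<subseteq> W \<and> card (\<chi> u) = 2"
      using \<chi> by (auto simp: line_model_def add_edge_def)
    let ?S = "\<chi> ` verts F"
    \<comment> \<open>Both sides are false for \<open>u = w\<close>, but isomorphisms quantify over equal vertices too.\<close>
    have "{u, w} \<in> edges F \<longleftrightarrow> {\<chi> u, \<chi> w} \<in> edges (induced (delete_edge ?G d) ?S)"
      if uw: "u \<in> verts F" "w \<in> verts F" for u w
    proof (cases "u = w")
      case True
      then show ?thesis
        using F line_graph_edge_iff[of "\<chi> u" "\<chi> u" "complete_graph W"]
        by (auto simp: finite_graph_def induced_def delete_edge_def)
    next
      case False
      have "{\<chi> u, \<chi> w} = d \<longleftrightarrow> {u, w} = {a, b}"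
        unfolding d_eq using inj_on_image_eq_iff[OF inj\<chi>, of "{u, w}" "{a, b}"] uw ab by simp
      moreover have "{\<chi> u, \<chi> w} \<in> edges ?G \<longleftrightarrow> \<chi> u \<inter> \<chi> w \<noteq> {}"
        using wf\<chi> uw False inj\<chi> by (auto simp: line_graph_edge_iff complete_graph_def dest: inj_onD)
      moreover have "{u, w} = {a, b} \<or> {u, w} \<in> edges F \<longleftrightarrow> \<chi> u \<inter> \<chi> w \<noteq> {}"
        using \<chi> uw False by (simp add: line_model_def add_edge_def)
      ultimately show ?thesis using uw ab(4) by (auto simp: induced_def delete_edge_def)
    qed
    then have "F \<cong>\<^sub>g induced (delete_edge ?G d) ?S"
      unfolding isomorphic_def using inj\<chi>
      by (intro exI[of _ \<chi>]) (simp add: induced_def bij_betw_def)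
    moreover have "?S \<subseteq> verts (delete_edge ?G d)"
      using wf\<chi> by (auto simp: delete_edge_def line_graph_def complete_graph_def)
    ultimately show ?thesis unfolding graph_free_def using isomorphic_sym by blast
  qed
  moreover have "{\<psi> a, \<psi> b} \<in> edges ?G"
    using wf ab \<psi>ab \<psi>ne by (simp add: line_graph_edge_iff complete_graph_def)
  moreover have "graph_free F ?G" using line_model_of_induced none by blast
  moreover have "finite_graph ?G"
    using W by (intro finite_graph_line_graph finite_graph_complete_graph)
  ultimately show ?thesis unfolding deletion_saturated_def by blast
qed

section \<open>Gluing two pendant edges\<close>

text \<open>Identification of the leaves \<open>x\<close> and \<open>y\<close> of the disjoint pendant edges \<open>a\<close> and \<open>b\<close> of \<open>J\<close>.
  The other end \<open>w\<close> of \<open>b\<close> is unchanged and \<open>x\<close> lies in no other edge than \<open>a\<close>, so \<open>b\<close> keeps its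
  neighbours in the line graph and gains only \<open>a\<close>.\<close>

lemma glue_private_ends:
  assumes \<phi>: "line_model F V \<phi>" and ab: "a \<in> verts F" "b \<in> verts F" "a \<noteq> b" "{a, b} \<notin> edges F"
    and x: "private_end F \<phi> a x" and y: "private_end F \<phi> b y"
  shows "line_model (add_edge F {a, b}) (V - {y}) (\<phi>(b := insert x (\<phi> b - {y})))"
    (is "line_model _ _ ?\<psi>")
proof -
  have inj: "inj_on \<phi> (verts F)" and wf: "\<And>u. u \<in> verts F \<Longrightarrow> \<phi> u \<subseteq> V \<and> card (\<phi> u) = 2"
    and adj: "\<And>u v. \<lbrakk>u \<in> verts F; v \<in> verts F; u \<noteq> v\<rbrakk> \<Longrightarrow> {u, v} \<in> edges F \<longleftrightarrow> \<phi> u \<inter> \<phi> v \<noteq> {}"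
    using \<phi> by (auto simp: line_model_def)
  have disj: "\<phi> a \<inter> \<phi> b = {}" using adj[OF ab(1-3)] ab(4) by simp
  have xa: "x \<in> \<phi> a" and x': "\<And>u. u \<in> verts F \<Longrightarrow> u \<noteq> a \<Longrightarrow> x \<notin> \<phi> u"
    using x by (auto simp: private_end_def)
  have yb: "y \<in> \<phi> b" and y': "\<And>u. u \<in> verts F \<Longrightarrow> u \<noteq> b \<Longrightarrow> y \<notin> \<phi> u"
    using y by (auto simp: private_end_def)
  obtain w where w: "\<phi> b = {y, w}" "y \<noteq> w" using card_2_mem_obtain wf[OF ab(2)] yb by metis
  have \<psi>b: "?\<psi> b = {x, w}" using w by auto
  have wa: "w \<notin> \<phi> a" "x \<noteq> w" "x \<noteq> y" using disj w xa by auto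
  have \<psi>: "?\<psi> u = \<phi> u" if "u \<noteq> b" for u using that by simp
  have meet: "?\<psi> u \<inter> ?\<psi> b \<noteq> {} \<longleftrightarrow> u = a \<or> {u, b} \<in> edges F" if "u \<in> verts F" "u \<noteq> b" for u
    using adj[OF that(1) ab(2) that(2)] \<psi>b w wa xa x'[OF that(1)] y'[OF that] that by auto
  have "?\<psi> u \<noteq> ?\<psi> b" if "u \<in> verts F" "u \<noteq> b" for u
    unfolding \<psi>b \<psi>[OF that(2)] using x'[OF that(1)] wa by (cases "u = a") auto
  then have "inj_on ?\<psi> (verts F)"
    using inj unfolding inj_on_def by (metis \<psi>)
  moreover have "?\<psi> u \<subseteq> V - {y} \<and> card (?\<psi> u) = 2" if "u \<in> verts F" for u
  proof (cases "u = b")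
    case True
    then show ?thesis unfolding True \<psi>b using wa w wf[OF ab(1)] wf[OF ab(2)] xa by auto
  next
    case False
    then show ?thesis using wf[OF that] y'[OF that] by auto
  qed
  moreover have "({u, v} = {a, b} \<or> {u, v} \<in> edges F) \<longleftrightarrow> ?\<psi> u \<inter> ?\<psi> v \<noteq> {}"
    if uv: "u \<in> verts F" "v \<in> verts F" "u \<noteq> v" for u v
  proof -
    consider "v = b" | "u = b" | "u \<noteq> b" "v \<noteq> b" by blast
    then show ?thesis
    proof cases
      case 1
      then show ?thesis using meet[OF uv(1)] uv(3) by (auto simp: doubleton_eq_iff)
    next
      case 2
      then show ?thesis using meet[OF uv(2)] uv(3)
        by (auto simp: doubleton_eq_iff insert_commute Int_commute)
    next
      case 3
      then show ?thesis using adj[OF uv] by (auto simp: doubleton_eq_iff)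
    qed
  qed
  ultimately show ?thesis unfolding line_model_def add_edge_def by simp
qed

section \<open>Making a leaf edge pendant\<close>

text \<open>Exchanging two vertices with the same neighbours is an automorphism.\<close>

lemma line_model_swap:
  assumes \<phi>: "line_model F V \<phi>" and ab: "a \<in> verts F" "b \<in> verts F"
    and twins: "\<And>u. \<lbrakk>u \<in> verts F; u \<noteq> a; u \<noteq> b\<rbrakk> \<Longrightarrow> {a, u} \<in> edges F \<longleftrightarrow> {b, u} \<in> edges F"
  shows "line_model F V (\<phi>(a := \<phi> b, b := \<phi> a))" (is "line_model F V ?\<phi>")
proof -
  have inj: "inj_on \<phi> (verts F)" and wf: "\<forall>u\<in>verts F. \<phi> u \<subseteq> V \<and> card (\<phi> u) = 2"
    and adj: "\<And>u v. \<lbrakk>u \<in> verts F; v \<in> verts F; u \<noteq> v\<rbrakk> \<Longrightarrow> {u, v} \<in> edges F \<longleftrightarrow> \<phi> u \<inter> \<phi> v \<noteq> {}"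
    using \<phi> by (auto simp: line_model_def)
  have "inj_on ?\<phi> (verts F)" using inj ab by (auto simp: inj_on_def)
  moreover have "{u, v} \<in> edges F \<longleftrightarrow> ?\<phi> u \<inter> ?\<phi> v \<noteq> {}"
    if uv: "u \<in> verts F" "v \<in> verts F" "u \<noteq> v" for u v
  proof -
    consider "u = a" "v = b" | "u = b" "v = a" | "u = a" "v \<noteq> a" "v \<noteq> b" | "u = b" "v \<noteq> a" "v \<noteq> b"
      | "v = a" "u \<noteq> a" "u \<noteq> b" | "v = b" "u \<noteq> a" "u \<noteq> b" | "u \<notin> {a, b}" "v \<notin> {a, b}"
      using uv(3) by auto
    then show ?thesis
    proof cases
      case 1
      then show ?thesis using adj[OF uv] uv(3) by (simp add: Int_commute)
    next
      case 2
      then show ?thesis using adj[OF uv] uv(3) by (simp add: Int_commute)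
    next
      case 3
      then show ?thesis using adj[OF ab(2) uv(2)] twins[OF uv(2)] by simp
    next
      case 4
      then show ?thesis using adj[OF ab(1) uv(2)] twins[OF uv(2)] by simp
    next
      case 5
      then show ?thesis using adj[OF uv(1) ab(2)] twins[OF uv(1)] by (simp add: insert_commute)
    next
      case 6
      then show ?thesis using adj[OF uv(1) ab(1)] twins[OF uv(1)] by (simp add: insert_commute)
    qed (use adj[OF uv] in auto)
  qed
  ultimately show ?thesis using wf ab unfolding line_model_def by simp
qed

lemma isolated_claw_is_component:
  assumes xypq: "distinct [x, y, p, q]" "{x, y, p, q} \<subseteq> verts H"
    and es: "{x, y} \<in> edges H" "{y, p} \<in> edges H" "{y, q} \<in> edges H"
    and only: "\<And>d. \<lbrakk>d \<in> edges H; d \<inter> {x, y, p, q} \<noteq> {}\<rbrakk> \<Longrightarrow> d \<in> {{x, y}, {y, p}, {y, q}}"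
  shows "\<exists>C\<in>components H. C \<cong>\<^sub>g claw \<and> x \<in> verts C"
proof -
  let ?S = "{u \<in> verts H. (x, u) \<in> (adj_rel H)\<^sup>*}"
  have "u \<in> {x, y, p, q}" if "(x, u) \<in> (adj_rel H)\<^sup>*" for u
    using that
  proof (induction rule: rtrancl_induct)
    case (step u w)
    then show ?case using only[of "{u, w}"] by (auto simp: adj_rel_def doubleton_eq_iff)
  qed simp
  moreover have xy: "(x, y) \<in> (adj_rel H)\<^sup>*" using es by (auto simp: adj_rel_def)
  moreover have "(x, p) \<in> (adj_rel H)\<^sup>*" "(x, q) \<in> (adj_rel H)\<^sup>*"
    using es xy by (auto simp: adj_rel_def intro: rtrancl_into_rtrancl)
  ultimately have S: "?S = {x, y, p, q}" using xypq(2) by auto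
  have E: "{d \<in> edges H. d \<subseteq> ?S} = {{x, y}, {y, p}, {y, q}} \<union> {d \<in> edges H. d = {}}"
    unfolding S using es only by auto
  define f where "f = (\<lambda>n::nat. if n = 0 then y else if n = 1 then x else if n = 2 then p else q)"
  have "bij_betw f (verts claw) ?S"
    unfolding S using xypq(1) by (auto simp: f_def claw_def bij_betw_def inj_on_def)
  moreover have "\<forall>u\<in>verts claw. \<forall>v\<in>verts claw. {u, v} \<in> edges claw
      \<longleftrightarrow> {f u, f v} \<in> edges (induced H ?S)"
    using xypq(1) unfolding induced_def E by (auto simp: f_def claw_def doubleton_eq_iff)
  ultimately have "claw \<cong>\<^sub>g induced H ?S"
    unfolding isomorphic_def by (intro exI[of _ f]) (simp add: induced_def)
  moreover have "induced H ?S \<in> components H" using xypq(2) by (auto simp: components_def)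
  moreover have "x \<in> verts (induced H ?S)" using xypq(2) by (simp add: induced_def)
  ultimately show ?thesis using isomorphic_sym by blast
qed

lemma leaf_edge_unique:
  assumes "leaf H x" "e \<in> edges H" "x \<in> e" "f \<in> edges H" "x \<in> f"
  shows "e = f"
proof -
  have "card {e \<in> edges H. x \<in> e} = 1" using assms(1) by (simp add: leaf_def degree_def)
  then obtain g where "{e \<in> edges H. x \<in> e} = {g}" by (auto simp: card_1_singleton_iff)
  moreover have "e \<in> {e \<in> edges H. x \<in> e}" "f \<in> {e \<in> edges H. x \<in> e}" using assms(2-5) by auto
  ultimately show ?thesis by simp
qed

text \<open>Write \<open>a = {x, y}\<close>, and suppose that \<open>J\<close> has further edges \<open>e\<close>, \<open>f\<close> at the two ends \<open>\<alpha>\<close>, \<open>\<beta>\<close> of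
  \<open>a\<close>. In \<open>H\<close> both contain \<open>y\<close>, say \<open>e = {y, p}\<close> and \<open>f = {y, q}\<close>, so they meet in \<open>J\<close> as well, which
  gives a triangle \<open>\<alpha>\<close>, \<open>\<beta>\<close>, \<open>\<gamma>\<close> of \<open>J\<close>. Another edge of \<open>H\<close> at \<open>y\<close> would have to meet all three sides
  of the triangle, which only the sides themselves do. Since the component of \<open>x\<close> is not a claw,
  there is another edge \<open>h\<close> at \<open>p\<close> or \<open>q\<close>; in \<open>J\<close> it passes through \<open>\<gamma>\<close> and avoids \<open>\<alpha>\<close>, \<open>\<beta>\<close>, so it
  meets both \<open>e\<close> and \<open>f\<close> and must be \<open>{p, q}\<close>. Hence \<open>a\<close> and \<open>h\<close> both have exactly the neighbours
  \<open>e\<close> and \<open>f\<close> in the line graph and can be exchanged, and the edge that represented \<open>h\<close> is pendant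
  in \<open>J\<close>.

  The last clause of the conclusion says that other leaf edges that are already pendant remain so,
  which allows the lemma to be applied to the two edges of a severed pair in turn.\<close>

lemma leaf_edge_gets_private_end:
  assumes H: "finite_graph H" and x: "leaf H x"
    and noclaw: "\<And>C. \<lbrakk>C \<in> components H; C \<cong>\<^sub>g claw\<rbrakk> \<Longrightarrow> x \<notin> verts C"
    and a: "a \<in> edges H" "x \<in> a" and \<phi>: "line_model (line_graph H) V \<phi>"
  shows "\<exists>\<phi>' z. line_model (line_graph H) V \<phi>' \<and> private_end (line_graph H) \<phi>' a z \<and>
    (\<forall>b y w. leaf H y \<longrightarrow> y \<in> b \<longrightarrow> b \<in> edges H \<longrightarrow> a \<inter> b = {} \<longrightarrow>
       private_end (line_graph H) \<phi> b w \<longrightarrow> private_end (line_graph H) \<phi>' b w)"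
proof (cases "\<exists>z. private_end (line_graph H) \<phi> a z")
  case True
  then show ?thesis using \<phi> by blast
next
  case False
  have VL: "verts (line_graph H) = edges H" by (simp add: line_graph_def)
  have inj: "\<And>e f. \<lbrakk>e \<in> edges H; f \<in> edges H; \<phi> e = \<phi> f\<rbrakk> \<Longrightarrow> e = f"
    and wf: "\<And>e. e \<in> edges H \<Longrightarrow> card (\<phi> e) = 2"
    using \<phi> by (auto simp: line_model_def VL dest: inj_onD)
  have adj: "\<phi> e \<inter> \<phi> f \<noteq> {} \<longleftrightarrow> e \<inter> f \<noteq> {}" if "e \<in> edges H" "f \<in> edges H" "e \<noteq> f" for e f
    using \<phi> that by (simp add: line_model_def VL line_graph_edge_iff)
  have two: "\<And>e. e \<in> edges H \<Longrightarrow> card e = 2" and sub: "\<And>e. e \<in> edges H \<Longrightarrow> e \<subseteq> verts H"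
    using H by (auto simp: finite_graph_def)
  obtain y where y: "a = {x, y}" "x \<noteq> y" using card_2_mem_obtain[OF two[OF a(1)] a(2)] .
  have at_x: "\<And>e. e \<in> edges H \<Longrightarrow> x \<in> e \<Longrightarrow> e = a" using leaf_edge_unique[OF x _ _ a] by blast
  have meet_a: "e \<inter> a \<noteq> {} \<longleftrightarrow> y \<in> e" if "e \<in> edges H" "e \<noteq> a" for e
    using at_x that y by auto
  obtain \<alpha> \<beta> where \<alpha>\<beta>: "\<phi> a = {\<alpha>, \<beta>}" "\<alpha> \<noteq> \<beta>" using wf[OF a(1)] by (auto simp: card_2_iff)
  obtain e where e: "e \<in> edges H" "e \<noteq> a" "\<alpha> \<in> \<phi> e"
    using False \<alpha>\<beta> unfolding private_end_def VL by blast
  obtain f where f: "f \<in> edges H" "f \<noteq> a" "\<beta> \<in> \<phi> f"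
    using False \<alpha>\<beta> unfolding private_end_def VL by blast
  have "\<beta> \<notin> \<phi> e" "\<alpha> \<notin> \<phi> f"
    using inj[OF e(1) a(1)] inj[OF f(1) a(1)] card_2_eqI[OF wf[OF e(1)] e(3), of \<beta>]
      card_2_eqI[OF wf[OF f(1)] _ f(3), of \<alpha>] e(2) f(2) \<alpha>\<beta> by auto
  have ef: "e \<noteq> f" using \<open>\<beta> \<notin> \<phi> e\<close> f by auto
  have ye: "y \<in> e" using meet_a[OF e(1,2)] adj[OF e(1) a(1) e(2)] e(3) \<alpha>\<beta> by auto
  have yf: "y \<in> f" using meet_a[OF f(1,2)] adj[OF f(1) a(1) f(2)] f(3) \<alpha>\<beta> by auto
  obtain \<gamma> where \<gamma>: "\<phi> e = {\<alpha>, \<gamma>}" "\<alpha> \<noteq> \<gamma>" using card_2_mem_obtain[OF wf[OF e(1)] e(3)] .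
  have \<gamma>f: "\<phi> f = {\<beta>, \<gamma>}" "\<beta> \<noteq> \<gamma>"
  proof -
    have "\<phi> e \<inter> \<phi> f \<noteq> {}" using adj[OF e(1) f(1) ef] ye yf by auto
    then have "\<gamma> \<in> \<phi> f" using \<gamma> \<open>\<alpha> \<notin> \<phi> f\<close> by auto
    moreover show "\<beta> \<noteq> \<gamma>" using \<open>\<beta> \<notin> \<phi> e\<close> \<gamma> by auto
    ultimately show "\<phi> f = {\<beta>, \<gamma>}" using card_2_eqI[OF wf[OF f(1)] f(3)] by blast
  qed
  obtain p where p: "e = {y, p}" "y \<noteq> p" using card_2_mem_obtain[OF two[OF e(1)] ye] .
  obtain q where q: "f = {y, q}" "y \<noteq> q" using card_2_mem_obtain[OF two[OF f(1)] yf] .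
  have xpq: "distinct [x, y, p, q]" using y p q ef at_x e f by auto
  \<comment> \<open>A pair that meets all three sides of a triangle is one of its sides.\<close>
  have at_y: "k \<in> {a, e, f}" if k: "k \<in> edges H" "y \<in> k" for k
  proof (rule ccontr)
    assume n: "k \<notin> {a, e, f}"
    have "\<phi> k \<inter> \<phi> a \<noteq> {}" "\<phi> k \<inter> \<phi> e \<noteq> {}" "\<phi> k \<inter> \<phi> f \<noteq> {}"
      using adj[OF k(1) a(1)] adj[OF k(1) e(1)] adj[OF k(1) f(1)] n k(2) y ye yf by auto
    then have "{\<alpha>, \<beta>} \<subseteq> \<phi> k \<or> {\<alpha>, \<gamma>} \<subseteq> \<phi> k \<or> {\<beta>, \<gamma>} \<subseteq> \<phi> k"
      using \<alpha>\<beta> \<gamma> \<gamma>f by auto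
    then have "\<phi> k = \<phi> a \<or> \<phi> k = \<phi> e \<or> \<phi> k = \<phi> f"
      using card_2_eqI[OF wf[OF k(1)]] \<alpha>\<beta> \<gamma> \<gamma>f by (metis insert_subset)
    then show False using n inj k(1) a(1) e(1) f(1) by blast
  qed
  \<comment> \<open>Edges that leave the star at \<open>y\<close> are opposite to \<open>a\<close>: in \<open>J\<close> they can meet the triangle only
    in \<open>\<gamma>\<close>, hence meet both \<open>e\<close> and \<open>f\<close>.\<close>
  have opposite: "k = {p, q} \<and> \<gamma> \<in> \<phi> k \<and> \<phi> k \<inter> \<phi> a = {}"
    if k: "k \<in> edges H" "k \<notin> {a, e, f}" "p \<in> k \<or> q \<in> k" for k
  proof -
    have yk: "y \<notin> k" using at_y k by blast
    then have ka: "\<phi> k \<inter> \<phi> a = {}" using adj[OF k(1) a(1)] meet_a[OF k(1)] k(2) by auto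
    moreover have "\<phi> k \<inter> \<phi> e \<noteq> {} \<or> \<phi> k \<inter> \<phi> f \<noteq> {}"
      using adj[OF k(1) e(1)] adj[OF k(1) f(1)] k p q by auto
    ultimately have g: "\<gamma> \<in> \<phi> k" using \<alpha>\<beta> \<gamma> \<gamma>f by auto
    then have "k \<inter> e \<noteq> {}" "k \<inter> f \<noteq> {}"
      using adj[OF k(1) e(1)] adj[OF k(1) f(1)] k(2) \<gamma> \<gamma>f by auto
    then have "p \<in> k" "q \<in> k" using p q yk by auto
    then have "k = {p, q}" using card_2_eqI[OF two[OF k(1)]] xpq by simp
    then show ?thesis using g ka by blast
  qed
  obtain h where h: "h \<in> edges H" "h \<notin> {a, e, f}" "p \<in> h \<or> q \<in> h"
  proof (rule ccontr)
    assume "\<not> thesis"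
    then have none: "\<And>k. \<lbrakk>k \<in> edges H; p \<in> k \<or> q \<in> k\<rbrakk> \<Longrightarrow> k \<in> {a, e, f}" using that by blast
    have "\<exists>C\<in>components H. C \<cong>\<^sub>g claw \<and> x \<in> verts C"
    proof (rule isolated_claw_is_component[OF xpq])
      show "{x, y, p, q} \<subseteq> verts H" using sub a(1) e(1) f(1) y p q by blast
      show "{x, y} \<in> edges H" "{y, p} \<in> edges H" "{y, q} \<in> edges H" using a(1) e(1) f(1) y p q by auto
      show "d \<in> {{x, y}, {y, p}, {y, q}}" if "d \<in> edges H" "d \<inter> {x, y, p, q} \<noteq> {}" for d
        using that none[of d] at_x[of d] at_y[of d] y(1) p(1) q(1) by blast
    qed
    then show False using noclaw by blast
  qed
  have hpq: "h = {p, q}" and h\<gamma>: "\<gamma> \<in> \<phi> h" and ha: "\<phi> h \<inter> \<phi> a = {}" using opposite[OF h] by auto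
  obtain \<delta> where \<delta>: "\<phi> h = {\<gamma>, \<delta>}" "\<gamma> \<noteq> \<delta>" using card_2_mem_obtain[OF wf[OF h(1)] h\<gamma>] .
  \<comment> \<open>So the component of \<open>x\<close> in \<open>H\<close> is the triangle \<open>y\<close>, \<open>p\<close>, \<open>q\<close> with the pendant edge \<open>a\<close>.\<close>
  have far: "k \<inter> {x, y, p, q} = {}" if "k \<in> edges H" "k \<notin> {a, e, f, h}" for k
    using that at_x[of k] at_y[of k] opposite[of k] hpq by blast
  let ?\<phi> = "\<phi>(a := \<phi> h, h := \<phi> a)"
  have "line_model (line_graph H) V ?\<phi>"
  proof (rule line_model_swap[OF \<phi>])
    show "a \<in> verts (line_graph H)" "h \<in> verts (line_graph H)" using a h VL by auto
    fix k assume k: "k \<in> verts (line_graph H)" "k \<noteq> a" "k \<noteq> h"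
    then consider "k = e" | "k = f" | "k \<notin> {a, e, f, h}" by blast
    then show "{a, k} \<in> edges (line_graph H) \<longleftrightarrow> {h, k} \<in> edges (line_graph H)"
    proof cases
      case 3
      then show ?thesis using far[of k] k(1) y hpq by (auto simp: VL line_graph_edge_iff)
    qed (use a e f h y p q hpq in \<open>auto simp: line_graph_edge_iff\<close>)
  qed
  moreover have "private_end (line_graph H) ?\<phi> a \<delta>"
  proof -
    have "\<delta> \<notin> ?\<phi> k" if k: "k \<in> edges H" "k \<noteq> a" for k
    proof -
      consider "k = h" | "k = e" | "k = f" | "k \<notin> {a, e, f, h}" using k by blast
      then show ?thesis
      proof cases
        case 4
        then have "\<phi> k \<inter> \<phi> h = {}" using adj[OF k(1) h(1)] far[OF k(1)] hpq by auto
        then show ?thesis using 4 \<delta> by auto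
      qed (use ha \<delta> \<alpha>\<beta> \<gamma> \<gamma>f e f h in auto)
    qed
    then show ?thesis using \<delta> h by (auto simp: private_end_def VL)
  qed
  moreover have "private_end (line_graph H) ?\<phi> b w"
    if b: "leaf H u" "u \<in> b" "b \<in> edges H" "a \<inter> b = {}" "private_end (line_graph H) \<phi> b w" for b u w
  proof -
    have "b \<noteq> a" using b(2,4) by auto
    \<comment> \<open>Both ends of \<open>h\<close> have degree at least two, so a leaf edge is not affected by the exchange.\<close>
    moreover have "b \<noteq> h"
    proof
      assume "b = h"
      then have "u = p \<or> u = q" using b(2) hpq by auto
      then show False
        using leaf_edge_unique[OF b(1) b(3) b(2) e(1)]
          leaf_edge_unique[OF b(1) b(3) b(2) f(1)] p q h \<open>b = h\<close> by auto
    qed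
    ultimately show ?thesis using b(5) a h by (auto simp: private_end_def VL)
  qed
  ultimately show ?thesis by blast
qed

section \<open>Line graphs of graphs with a severed pair\<close>

theorem theorem5p2:
  fixes H :: "'a ugraph"
  assumes "finite_graph H"
    and "\<exists>x y. severed H x y"
  shows "deletion_normal (line_graph H)"
proof -
  let ?F = "line_graph H"
  have VL: "verts ?F = edges H" by (simp add: line_graph_def)
  obtain x y where x: "leaf H x" and y: "leaf H y" and far: "distance H x y \<ge> 3"
    and noclaw: "\<And>C. \<lbrakk>C \<in> components H; C \<cong>\<^sub>g claw\<rbrakk> \<Longrightarrow> x \<notin> verts C"
      "\<And>C. \<lbrakk>C \<in> components H; C \<cong>\<^sub>g claw\<rbrakk> \<Longrightarrow> y \<notin> verts C"
    using assms(2) unfolding severed_def by blast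
  have two: "\<And>e. e \<in> edges H \<Longrightarrow> e \<subseteq> verts H \<and> card e = 2"
    using assms(1) by (auto simp: finite_graph_def)
  have leaf_edge: "\<exists>e\<in>edges H. z \<in> e" if "leaf H z" for z
  proof -
    have "{e \<in> edges H. z \<in> e} \<noteq> {}" using that unfolding leaf_def degree_def by (metis card.empty zero_neq_one)
    then show ?thesis by blast
  qed
  obtain a where a: "a \<in> edges H" "x \<in> a" using leaf_edge[OF x] by blast
  obtain b where b: "b \<in> edges H" "y \<in> b" using leaf_edge[OF y] by blast
  obtain s where s: "a = {x, s}" using card_2_mem_obtain two[OF a(1)] a(2) by metis
  obtain t where t: "b = {y, t}" using card_2_mem_obtain two[OF b(1)] b(2) by metis
  have disj: "a \<inter> b = {}"
    using far a b unfolding distance_ge_3_iff s t by (auto simp: insert_commute)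
  have ab: "a \<in> verts ?F" "b \<in> verts ?F" "a \<noteq> b" "{a, b} \<notin> edges ?F"
    using a b disj by (auto simp: VL line_graph_edge_iff)

  \<comment> \<open>The vertices of \<open>H\<close> themselves serve as the points, so \<open>V\<close> may be sought in the same type.\<close>
  define repr where "repr = (\<lambda>V. finite V \<and> (\<exists>\<phi> :: 'a set \<Rightarrow> 'a set. line_model ?F V \<phi>))"
  have "line_model ?F (verts H) id"
    using two by (auto simp: line_model_def VL line_graph_edge_iff)
  then have "repr (verts H)" using assms(1) by (auto simp: repr_def finite_graph_def)
  then obtain V where V: "repr V" and minimal: "\<And>W. repr W \<Longrightarrow> card V \<le> card W"
    using ex_has_least_nat[of repr _ card] by blast
  then obtain \<phi>0 where \<phi>0: "line_model ?F V \<phi>0" by (auto simp: repr_def)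
  obtain \<phi>1 z1 where \<phi>1: "line_model ?F V \<phi>1" "private_end ?F \<phi>1 a z1"
    using leaf_edge_gets_private_end[OF assms(1) x noclaw(1) a \<phi>0] by blast
  obtain \<phi> z2 where \<phi>: "line_model ?F V \<phi>" "private_end ?F \<phi> b z2" "private_end ?F \<phi> a z1"
    using leaf_edge_gets_private_end[OF assms(1) y noclaw(2) b \<phi>1(1)] \<phi>1(2) x a disj
    by (metis Int_commute)
  let ?W = "V - {z2}"
  have glued: "line_model (add_edge ?F {a, b}) ?W (\<phi>(b := insert z1 (\<phi> b - {z2})))"
    using glue_private_ends[OF \<phi>(1) ab \<phi>(3,2)] .
  have "z2 \<in> V" using \<phi>(1,2) ab(2) by (auto simp: line_model_def private_end_def)
  moreover have "finite V" using V by (simp add: repr_def)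
  ultimately have "card ?W < card V" by (intro psubset_card_mono) auto
  then have "\<nexists>\<phi> :: 'a set \<Rightarrow> 'a set. line_model ?F ?W \<phi>"
    using minimal[of ?W] \<open>finite V\<close> by (auto simp: repr_def)
  then have "deletion_saturated ?F (line_graph (complete_graph ?W))"
    using saturated_line_graph_of_complete[OF finite_graph_line_graph[OF assms(1)] ab _ _ glued]
      \<open>finite V\<close> by blast
  then show ?thesis by (rule deletion_normalI)
qed

end
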